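(* Let $n \ge 0$ be a natural number, let $A \in \mathbb{R}^{(n+1)\times(n+1)}$ and $b \in \mathbb{R}^{n+1}$. Suppose that $A$ is invertible, that $A_{ii} > 0$ for all $i$, that $A_{ij} = A_{ji}$ for all $i,j$, and that $A$ is positive definite in the sense that $\mathrm{Re}(v^{*} A v) > 0$ for every nonzero $v \in \mathbb{C}^{n+1}$. Let $x = A^{-1} b$. Then for every $x_0 \in \mathbb{R}^{n+1}$, the Gauss--Seidel iterates $(x_k)_{k\ge 0}$ for $Ax=b$ started at $x_0$ satisfy $$\lim_{k \to \infty} \|x_{k+1} - x\|_2 = 0.$$
   Context: Write $A = M + N$, where $M$ is the lower triangular part of $A$ including the diagonal ($M_{ij} = A_{ij}$ if $i \ge j$, and $0$ otherwise) and $N$ is the strictly upper triangular part of $A$ ($N_{ij} = A_{ij}$ if $i<j$, and $0$ otherwise). The Gauss--Seidel iterates started at $x_0$ are defined recursively by $x_{k+1} = -M^{-1} N x_k + M^{-1} b$ for $k \ge 0$. Here $v^{*}$ denotes the conjugate transpose of $v$, and $\|\cdot\|_2$ is the Euclidean ($\ell^2$) vector norm. *)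

theory Defs
  imports "HOL-Analysis.Analysis"
begin

text \<open>
  Rows and columns are indexed by a finite linearly ordered type; such a type is nonempty and
  order-isomorphic to \<open>{0..n}\<close> with \<open>n + 1 = CARD('n)\<close>, so the order determines the
  triangular parts.
\<close>

definition lower_part :: "real^('n::{finite,linorder})^('n::{finite,linorder}) \<Rightarrow> real^('n::{finite,linorder})^('n::{finite,linorder})" where
  "lower_part A = (\<chi> i j. if i \<ge> j then A $ i $ j else 0)"

definition strict_upper_part :: "real^('n::{finite,linorder})^('n::{finite,linorder}) \<Rightarrow> real^('n::{finite,linorder})^('n::{finite,linorder})" where
  "strict_upper_part A = (\<chi> i j. if i < j then A $ i $ j else 0)"

primrec gauss_seidel ::
  "real^('n::{finite,linorder})^('n::{finite,linorder}) \<Rightarrow> real^('n::{finite,linorder}) \<Rightarrow> real^('n::{finite,linorder})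
    \<Rightarrow> nat \<Rightarrow> real^('n::{finite,linorder})" where
  "gauss_seidel A b x0 0 = x0"
| "gauss_seidel A b x0 (Suc k) =
     - ((matrix_inv (lower_part A) ** strict_upper_part A) *v gauss_seidel A b x0 k)
     + matrix_inv (lower_part A) *v b"

text \<open>The sum is \<open>v\<^sup>* A v\<close>, with the real matrix \<open>A\<close> acting on complex vectors.\<close>

definition pos_def_real_part :: "real^'n^'n \<Rightarrow> bool" where
  "pos_def_real_part A \<longleftrightarrow>
     (\<forall>v :: complex^'n. v \<noteq> 0 \<longrightarrow>
        Re (\<Sum>i\<in>UNIV. cnj (v $ i) * (map_matrix complex_of_real A *v v) $ i) > 0)"

end

(* The energy q v = v \<bullet> (A *v v) of the error decreases along the iteration: with D the diagonal
   of A and d the difference of successive errors e, e', symmetry gives q e' = q e - d \<bullet> (D *v d).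
   As q is bounded below by 0, the decrements tend to 0, so d tends to 0 because D is positive.
   Finally A *v e = lower_part A *v d, so e tends to 0 because A is invertible. *)
theory Submission
  imports Defs
begin

lemma inner_symmetric_matrix_commute:
  fixes A :: "real^'n^'n"
  assumes "transpose A = A"
  shows "u \<bullet> (A *v v) = v \<bullet> (A *v u)"
  by (metis assms dot_lmul_matrix inner_commute transpose_matrix_vector)

text \<open>By symmetry, \<open>lower_part A\<close> plus its transpose is \<open>A\<close> with the
  diagonal counted twice, and a matrix and its transpose have the same quadratic form.\<close>

lemma quadratic_form_lower_part:
  fixes A :: "real^('n::{finite,linorder})^('n::{finite,linorder})"
  assumes "transpose A = A"
  shows "2 * (v \<bullet> (lower_part A *v v)) = v \<bullet> (A *v v) + (\<Sum>i\<in>UNIV. A $ i $ i * (v $ i)\<^sup>2)"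
proof -
  let ?M = "lower_part A"
  define D :: "real^('n::{finite,linorder})^('n::{finite,linorder})"
    where "D = (\<chi> i j. if i = j then A $ i $ i else 0)"
  have symm: "A $ i $ j = A $ j $ i" for i j
    using assms by (metis transpose_def vec_lambda_beta)
  have "?M + transpose ?M = A + D"
    using symm by (auto simp: vec_eq_iff lower_part_def transpose_def D_def)
  then have "v \<bullet> (?M *v v) + v \<bullet> (transpose ?M *v v) = v \<bullet> (A *v v) + v \<bullet> (D *v v)"
    by (metis inner_add_right matrix_vector_mult_add_rdistrib)
  moreover have "v \<bullet> (transpose ?M *v v) = v \<bullet> (?M *v v)"
    by (metis dot_lmul_matrix inner_commute transpose_matrix_vector)
  moreover have "(D *v v) $ i = A $ i $ i * v $ i" for i
    by (simp add: matrix_vector_mult_def D_def if_distrib[of "\<lambda>z. z * _"] cong: if_cong)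
  then have "v \<bullet> (D *v v) = (\<Sum>i\<in>UNIV. A $ i $ i * (v $ i)\<^sup>2)"
    by (simp add: inner_vec_def power2_eq_square algebra_simps)
  ultimately show ?thesis by simp
qed

text \<open>The complex condition is tested on a real vector embedded in \<open>complex^'n\<close>,
  where the Hermitian form reduces to the real one.\<close>

lemma pos_def_real_part_imp_nonneg:
  fixes A :: "real^'n^'n"
  assumes "pos_def_real_part A"
  shows "v \<bullet> (A *v v) \<ge> 0"
proof (cases "v = 0")
  case False
  define w :: "complex^'n" where "w = (\<chi> i. complex_of_real (v $ i))"
  have "w \<noteq> 0" using False by (auto simp: w_def vec_eq_iff)
  then have "Re (\<Sum>i\<in>UNIV. cnj (w $ i) * (map_matrix complex_of_real A *v w) $ i) > 0"
    using assms by (auto simp: pos_def_real_part_def)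
  moreover have "(map_matrix complex_of_real A *v w) $ i = complex_of_real ((A *v v) $ i)" for i
    by (simp add: matrix_vector_mult_def map_matrix_def w_def)
  ultimately show ?thesis by (simp add: w_def inner_vec_def)
qed simp

text \<open>The kernel is trivial: if \<open>lower_part A\<close> kills \<open>v\<close>, the
  identity for its quadratic form leaves the sum of two nonnegative terms equal to 0, so the
  diagonal term vanishes and with it every coordinate of \<open>v\<close>.\<close>

lemma invertible_lower_part:
  fixes A :: "real^('n::{finite,linorder})^('n::{finite,linorder})"
  assumes "transpose A = A" and "\<And>i. A $ i $ i > 0" and "\<And>v. v \<bullet> (A *v v) \<ge> 0"
  shows "invertible (lower_part A)"
proof -
  have "v = 0" if "lower_part A *v v = 0" for v
  proof -
    have "(\<Sum>i\<in>UNIV. A $ i $ i * (v $ i)\<^sup>2) \<le> 0"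
      using quadratic_form_lower_part[OF assms(1), of v] assms(3)[of v] that by simp
    moreover have nonneg: "A $ i $ i * (v $ i)\<^sup>2 \<ge> 0" for i
      using assms(2)[of i] by simp
    ultimately have "(\<Sum>i\<in>UNIV. A $ i $ i * (v $ i)\<^sup>2) = 0"
      by (meson order_antisym sum_nonneg)
    then have "A $ i $ i * (v $ i)\<^sup>2 = 0" for i
      using nonneg by (simp add: sum_nonneg_eq_0_iff)
    then show ?thesis
      using assms(2) by (simp add: vec_eq_iff) (metis less_irrefl)
  qed
  then show ?thesis
    by (metis invertible_left_inverse matrix_left_invertible_ker)
qed

lemma
  fixes A :: "real^'n^'m"
  assumes "invertible A"
  shows matrix_inv_right: "A ** matrix_inv A = mat 1"
    and matrix_inv_left: "matrix_inv A ** A = mat 1"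
  using someI_ex[OF assms[unfolded invertible_def]] by (simp_all add: matrix_inv_def)

theorem mainTheorem1:
  fixes n :: nat
    and A :: "real^('n::{finite,linorder})^('n::{finite,linorder})"
    and b x :: "real^('n::{finite,linorder})"
  assumes dim: "CARD('n) = n + 1"
    and inv: "invertible A"
    and diag_pos: "\<And>i. A $ i $ i > 0"
    and symm: "\<And>i j. A $ i $ j = A $ j $ i"
    and posdef: "pos_def_real_part A"
    and x_def: "x = matrix_inv A *v b"
  shows "\<forall>x0 :: real^('n::{finite,linorder}). (\<lambda>k. norm (gauss_seidel A b x0 (k + 1) - x)) \<longlonglongrightarrow> 0"
proof
  fix x0
  let ?M = "lower_part A" and ?N = "strict_upper_part A"
  have A_sym: "transpose A = A" using symm by (simp add: vec_eq_iff transpose_def)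
  note psd = pos_def_real_part_imp_nonneg[OF posdef]
  have M_inv: "?M ** matrix_inv ?M = mat 1"
    using invertible_lower_part[OF A_sym diag_pos psd] by (rule matrix_inv_right)
  have split: "A *v v = ?M *v v + ?N *v v" for v
  proof -
    have "A = ?M + ?N" by (auto simp: vec_eq_iff lower_part_def strict_upper_part_def)
    then show ?thesis by (metis matrix_vector_mult_add_rdistrib)
  qed
  have Ax: "A *v x = b"
    using matrix_inv_right[OF inv] by (simp add: x_def matrix_vector_mul_assoc)
  define e where "e k = gauss_seidel A b x0 k - x" for k
  define d where "d k = e k - e (Suc k)" for k
  define q where "q k = e k \<bullet> (A *v e k)" for k
  \<comment> \<open>Multiplying the recursion by \<open>?M\<close> clears both inverses. Since
    \<open>b = A *v x\<close>, the vector \<open>A *v e k\<close> is the residual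
    \<open>?M *v ?g k + ?N *v ?g k - b\<close>, that is,
    \<open>?M *v (?g k - ?g (Suc k))\<close>.\<close>
  have step: "A *v e k = ?M *v d k" for k
  proof -
    let ?g = "gauss_seidel A b x0"
    have "?M *v ?g (Suc k) = b - ?N *v ?g k"
      using M_inv
      by (simp add: matrix_vector_mult_diff_distrib matrix_vector_mul_assoc matrix_mul_assoc)
    then show ?thesis
      using split[of "?g k"]
      by (simp add: e_def d_def matrix_vector_mult_diff_distrib Ax del: gauss_seidel.simps)
  qed
  have decrement: "q k - q (Suc k) = (\<Sum>i\<in>UNIV. A $ i $ i * (d k $ i)\<^sup>2)" for k
  proof -
    have "e (Suc k) = e k - d k" by (simp add: d_def)
    \<comment> \<open>After \<open>A *v e k\<close> is replaced by \<open>?M *v d k\<close>, the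
      cross term is twice the quadratic form of \<open>?M\<close> at \<open>d k\<close>; its
      \<open>A\<close> part cancels the last summand and only the diagonal sum remains.\<close>
    then have "q (Suc k) = q k - 2 * (d k \<bullet> (A *v e k)) + d k \<bullet> (A *v d k)"
      using inner_symmetric_matrix_commute[OF A_sym, of "e k" "d k"]
      by (simp add: q_def matrix_vector_mult_diff_distrib inner_diff_left inner_diff_right)
    then show ?thesis
      using quadratic_form_lower_part[OF A_sym, of "d k"] by (simp add: step)
  qed
  have nonneg: "A $ i $ i * (d k $ i)\<^sup>2 \<ge> 0" for i k
    using diag_pos[of i] by simp
  have "decseq q"
  proof (rule decseq_SucI)
    fix k
    have "0 \<le> q k - q (Suc k)"
      unfolding decrement by (intro sum_nonneg nonneg)
    then show "q (Suc k) \<le> q k" by simp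
  qed
  moreover have "q k \<ge> 0" for k by (simp add: q_def psd)
  \<comment> \<open>The value of \<open>L\<close> is irrelevant: convergence alone forces the
    successive differences to 0.\<close>
  ultimately obtain L where L: "q \<longlonglongrightarrow> L" by (metis decseq_convergent)
  have dec0: "(\<lambda>k. q k - q (Suc k)) \<longlonglongrightarrow> 0"
    using tendsto_diff[OF L LIMSEQ_Suc[OF L]] by simp
  have "(\<lambda>k. d k $ i) \<longlonglongrightarrow> 0" for i
  proof -
    \<comment> \<open>All summands of the decrement are nonnegative, so each one is squeezed between
      0 and the whole.\<close>
    have "A $ i $ i * (d k $ i)\<^sup>2 \<le> q k - q (Suc k)" for k
      unfolding decrement using nonneg by (intro member_le_sum) auto
    then have "(\<lambda>k. A $ i $ i * (d k $ i)\<^sup>2) \<longlonglongrightarrow> 0"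
      using nonneg by (intro tendsto_sandwich[OF _ _ tendsto_const dec0]) auto
    from tendsto_mult_left[OF this, of "inverse (A $ i $ i)"]
    have "(\<lambda>k. (d k $ i)\<^sup>2) \<longlonglongrightarrow> 0"
      using diag_pos[of i] by (simp flip: mult.assoc)
    from tendsto_real_sqrt[OF this] show ?thesis
      by (simp add: tendsto_rabs_zero_iff)
  qed
  then have "d \<longlonglongrightarrow> 0" by (intro vec_tendstoI) simp
  \<comment> \<open>A fixed linear map recovers \<open>e k\<close> from \<open>d k\<close>, so
    continuity carries the limit over to the errors.\<close>
  then have "(\<lambda>k. (matrix_inv A ** ?M) *v d k) \<longlonglongrightarrow> (matrix_inv A ** ?M) *v 0"
    by (intro bounded_linear.tendsto[OF matrix_vector_mul_bounded_linear])
  moreover have "(matrix_inv A ** ?M) *v d k = e k" for k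
    by (metis step matrix_vector_mul_assoc matrix_inv_left[OF inv] matrix_vector_mul_lid)
  ultimately have "e \<longlonglongrightarrow> 0" by simp
  from tendsto_norm_zero[OF LIMSEQ_Suc[OF this]]
  show "(\<lambda>k. norm (gauss_seidel A b x0 (k + 1) - x)) \<longlonglongrightarrow> 0" by (simp add: e_def)
qed

end
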